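(* For every integer $n\ge 0$ and every $\alpha>0$, $$\Phi_{1/\alpha,\,(4n+2)^2\alpha}^{(4n+2)}=\frac{1}{2n+1}\sqrt{\frac{\alpha}{2}}\left(\left\{\phi_{\alpha}\left(\tfrac{i}{2}\right)\right\}^2+2\sum_{k=1}^n(-1)^{k}\,\phi_{\alpha}\Big(\tfrac{2n+2k+1}{4n+2}\,i\Big)\,\phi_{\alpha}\Big(\tfrac{2n-2k+1}{4n+2}\,i\Big)\right).$$
   Context: The double Mordell integral is $$\Phi_{\alpha,\beta}^{(\gamma)}=\int_0^\infty\!\int_0^\infty\frac{\cos (\pi \gamma xy)}{\cosh \pi x\,\cosh \pi y}\,e^{-\pi(\alpha x^2+\beta y^2)/2}\,dx\,dy,$$ and the one-dimensional Mordell integral is $$\phi_\alpha(\theta)=\int_0^\infty\frac{\cos(\pi \theta x)}{\cosh \pi x}\,e^{-\pi \alpha x^2}\,dx ,$$ so that $\phi_\alpha(is)=\int_0^\infty\frac{\cosh(\pi s x)}{\cosh\pi x}e^{-\pi\alpha x^2}dx$ for real $s$.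
   Formalization: The right-hand side carries an extra overall factor (-1)^n: as printed the formula is false for every odd n (for n=1 the left side is positive and the right side negative); for even n nothing changes. *)

theory Defs
  imports "HOL-Analysis.Analysis"
begin

text \<open>Both integrands decay exponentially in the parameter range of interest (the
  coefficients of the squares nonnegative and, for \<open>mordell1\<close>, \<open>\<bar>Im \<theta>\<bar> < 1\<close> or \<open>\<alpha> > 0\<close>),
  so the Lebesgue integrals below converge absolutely there, and the order of integration
  in \<open>mordell2\<close> is immaterial.\<close>

definition mordell2 :: "real \<Rightarrow> real \<Rightarrow> real \<Rightarrow> real" where
  "mordell2 \<alpha> \<beta> \<gamma> =
    (LINT y:{0..}|lborel. (LINT x:{0..}|lborel.
       cos (pi * \<gamma> * x * y) / (cosh (pi * x) * cosh (pi * y))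
         * exp (- pi * (\<alpha> * x\<^sup>2 + \<beta> * y\<^sup>2) / 2)))"

definition mordell1 :: "real \<Rightarrow> complex \<Rightarrow> complex" where
  "mordell1 \<alpha> \<theta> =
    (LINT x:{0..}|lborel.
       cos (complex_of_real pi * \<theta> * complex_of_real x)
         / complex_of_real (cosh (pi * x))
         * complex_of_real (exp (- pi * \<alpha> * x\<^sup>2)))"

text \<open>Pitfall: the evaluation of \<open>mordell2 (1 / \<alpha>) ((4 * n + 2)\<^sup>2 * \<alpha>) (4 * n + 2)\<close> carries an
  overall sign \<open>(-1) ^ n\<close>, which the published formula omits. For \<open>\<alpha> > 0\<close> this integral is
  positive (its inner integral is a Fourier transform of a product of a Gaussian and
  \<open>sech\<close>, i.e. a convolution of positive functions), whereas for \<open>n = 1\<close> the bracket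
  \<open>\<phi>(i/2)\<^sup>2 - 2 \<phi>(5i/6) \<phi>(i/6)\<close> is negative, because \<open>s \<mapsto> \<phi>(is)\<close> is
  log-convex.\<close>

end

(*
  Put m = 2n + 1. Replacing 1 / cosh (pi x) by its Fourier integral and carrying out the Gaussian
  integral over x turns the double integral, up to the factor sqrt (2 alpha) / (8 m), into
    P = int int exp (- pi alpha (t^2 + w^2)) / (cosh (pi t) cosh A) dt dw,  A = pi (t + w) / (2 m).
  Averaging over the exchange of t and w replaces 1 / cosh (pi t) by
  (cosh (pi t) + cosh (pi w)) / (2 cosh (pi t) cosh (pi w)), and by
  cosh (pi t) + cosh (pi w) = 2 cosh (m A) cosh (pi (t - w) / 2)
  the factor cosh A cancels: since m is odd, cosh (m A) / cosh A is a signed sum of the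
  cosh (2 k A). Every resulting term factors into one-dimensional Mordell integrals.
*)
theory Submission
  imports Defs "HOL-Probability.Characteristic_Functions"
    "HOL-Complex_Analysis.Cauchy_Integral_Theorem" "HOL-Real_Asymp.Real_Asymp"
begin

section \<open>Integrals over the line and the plane\<close>

text \<open>Contour arguments give information on finite intervals. Dominated convergence with
  majorant \<open>norm (f t)\<close> carries it over to the integral on the whole line.\<close>

lemma integral_symmetric_tendsto:
  fixes f :: "real \<Rightarrow> 'a::euclidean_space"
  assumes f: "integrable lborel f"
  shows "(\<lambda>n::nat. integral {-real n..real n} f) \<longlonglongrightarrow> (LINT t|lborel. f t)"
proof -
  have "(\<lambda>n::nat. LINT t|lborel. indicator {-real n..real n} t *\<^sub>R f t)
      \<longlonglongrightarrow> (LINT t|lborel. f t)"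
  proof (rule integral_dominated_convergence[where w = "\<lambda>t. norm (f t)"])
    show "AE t in lborel. (\<lambda>n::nat. indicator {-real n..real n} t *\<^sub>R f t) \<longlonglongrightarrow> f t"
    proof (intro AE_I2 tendsto_eventually)
      fix t :: real
      obtain N :: nat where N: "\<bar>t\<bar> \<le> real N"
        using real_arch_simple by blast
      show "\<forall>\<^sub>F n in sequentially. indicator {-real n..real n} t *\<^sub>R f t = f t"
        using eventually_ge_at_top[of N]
      proof eventually_elim
        fix n assume "N \<le> n"
        then have "\<bar>t\<bar> \<le> real n" using N by linarith
        then show "indicator {-real n..real n} t *\<^sub>R f t = f t" by (auto simp: indicator_def)
      qed
    qed
  qed (use f in \<open>auto split: split_indicator\<close>)
  moreover have "(LINT t|lborel. indicator {-real n..real n} t *\<^sub>R f t) = integral {-real n..real n} f" for n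
  proof -
    have "set_integrable lborel {-real n..real n} f"
      unfolding set_integrable_def by (intro integrable_mult_indicator f) auto
    from set_borel_integral_eq_integral(2)[OF this] show ?thesis
      by (simp add: set_lebesgue_integral_def)
  qed
  ultimately show ?thesis by simp
qed

lemma integrable_mult_bounded:
  fixes f g :: "real \<Rightarrow> real"
  assumes "integrable lborel f" "g \<in> borel_measurable borel" "\<And>x. \<bar>g x\<bar> \<le> 1"
  shows "integrable lborel (\<lambda>x. f x * g x)"
proof (rule Bochner_Integration.integrable_bound[OF assms(1)])
  note [measurable] = borel_measurable_integrable[OF assms(1)] assms(2)
  show "(\<lambda>x. f x * g x) \<in> borel_measurable lborel" by measurable
  show "AE x in lborel. norm (f x * g x) \<le> norm (f x)"
    using assms(3) by (auto simp: abs_mult intro!: mult_left_le)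
qed

lemma integrable_tensor:
  fixes f g :: "real \<Rightarrow> real"
  assumes "integrable lborel f" "integrable lborel g"
  shows "integrable (lborel \<Otimes>\<^sub>M lborel) (\<lambda>(x, y). f x * g y)"
    "(LINT z|(lborel \<Otimes>\<^sub>M lborel). (case z of (x, y) \<Rightarrow> f x * g y)) = (LINT x|lborel. f x) * (LINT y|lborel. g y)"
proof -
  note [measurable] = borel_measurable_integrable[OF assms(1)] borel_measurable_integrable[OF assms(2)]
  show "integrable (lborel \<Otimes>\<^sub>M lborel) (\<lambda>(x, y). f x * g y)"
    using assms by (intro lborel_pair.Fubini_integrable)
      (auto simp: norm_mult abs_mult split: prod.split)
  from lborel_pair.integral_fst[OF this]
  show "(LINT z|(lborel \<Otimes>\<^sub>M lborel). (case z of (x, y) \<Rightarrow> f x * g y)) = (LINT x|lborel. f x) * (LINT y|lborel. g y)"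
    by simp
qed

text \<open>Reduces the joint integrability behind Fubini's theorem to one-variable facts. The
  majorants used below are products of two Gaussians, of two hyperbolic secants, or of one of
  each.\<close>

lemma integrable_pair_dominated:
  fixes h :: "real \<Rightarrow> real \<Rightarrow> real"
  assumes f: "integrable lborel f" and g: "integrable lborel g"
    and h: "case_prod h \<in> borel_measurable (lborel \<Otimes>\<^sub>M lborel)"
    and bound: "\<And>x y. \<bar>h x y\<bar> \<le> f x * g y"
  shows "integrable (lborel \<Otimes>\<^sub>M lborel) (case_prod h)"
proof (rule Bochner_Integration.integrable_bound[OF _ h])
  show "integrable (lborel \<Otimes>\<^sub>M lborel) (\<lambda>(x, y). f x * g y)"
    by (rule integrable_tensor(1)[OF f g])
  show "AE z in lborel \<Otimes>\<^sub>M lborel. norm (case_prod h z) \<le> norm (case z of (x, y) \<Rightarrow> f x * g y)"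
    using bound by (intro AE_I2) (auto intro: order_trans[OF _ abs_ge_self])
qed

lemma even_integral_half_line:
  fixes f :: "real \<Rightarrow> real"
  assumes "integrable lborel f" "\<And>x. f (- x) = f x"
  shows "(LINT x:{0..}|lborel. f x) = (LINT x|lborel. f x) / 2"
proof -
  have "integrable lborel (\<lambda>x. indicator {0..} x *\<^sub>R f x)"
    using assms(1) by (intro integrable_mult_indicator) auto
  from has_bochner_integral_even_function[OF has_bochner_integral_integrable[OF this] assms(2)]
  show ?thesis
    by (simp add: set_lebesgue_integral_def has_bochner_integral_integral_eq)
qed

lemma odd_integral_eq_0:
  fixes f :: "real \<Rightarrow> real"
  assumes "\<And>x. f (- x) = - f x"
  shows "(LINT x|lborel. f x) = 0"
  using lborel_integral_real_affine[of "-1" f 0] assms by simp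

section \<open>The Fourier transform of the hyperbolic secant\<close>

lemma borel_measurable_cosh_real [measurable]:
  fixes f :: "'a \<Rightarrow> real"
  assumes [measurable]: "f \<in> borel_measurable M"
  shows "(\<lambda>x. cosh (f x)) \<in> borel_measurable M"
  unfolding cosh_field_def by measurable

text \<open>The antiderivative \<open>?F\<close> increases from 0 at minus infinity to 1 at
  infinity. Since the integrand is nonnegative, the fundamental theorem on the line yields
  integrability and value together.\<close>

lemma sech_integrable: "integrable lborel (\<lambda>t::real. 1 / cosh (pi * t))"
  and sech_integral: "(LINT t|lborel. 1 / cosh (pi * t)) = 1"
proof -
  let ?F = "\<lambda>t. 2 / pi * arctan (exp (pi * t))"
  have D: "DERIV ?F t :> 1 / cosh (pi * t)" for t :: real
  proof -
    have *: "1 + (exp (pi * t))\<^sup>2 \<noteq> 0"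
      by (metis sum_power2_eq_zero_iff one_power2 zero_neq_one)
    have "DERIV ?F t :> 2 / pi * (1 / (1 + (exp (pi * t))\<^sup>2) * (exp (pi * t) * pi))"
      by (auto intro!: derivative_eq_intros simp: divide_inverse)
    also have "2 / pi * (1 / (1 + (exp (pi * t))\<^sup>2) * (exp (pi * t) * pi)) = 1 / cosh (pi * t)"
      using * by (simp add: cosh_field_def exp_minus power2_eq_square divide_simps)
    finally show ?thesis .
  qed
  have L: "(?F \<longlongrightarrow> 0) at_bot"
  proof -
    have "filterlim (\<lambda>t::real. exp (pi * t)) (nhds 0) at_bot"
      by (rule filterlim_compose[OF exp_at_bot]) real_asymp
    then have "((\<lambda>t. 2 / pi * arctan (exp (pi * t))) \<longlongrightarrow> 2 / pi * arctan 0) at_bot"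
      by (intro tendsto_intros)
    then show ?thesis by simp
  qed
  have U: "(?F \<longlongrightarrow> 1) at_top"
  proof -
    have "filterlim (\<lambda>t::real. exp (pi * t)) at_top at_top"
      by (rule filterlim_compose[OF exp_at_top]) real_asymp
    then have "((\<lambda>t. arctan (exp (pi * t))) \<longlongrightarrow> pi / 2) at_top"
      by (rule filterlim_compose[OF tendsto_arctan_at_top])
    then have "((\<lambda>t. 2 / pi * arctan (exp (pi * t))) \<longlongrightarrow> 2 / pi * (pi / 2)) at_top"
      by (intro tendsto_intros)
    then show ?thesis by simp
  qed
  have FTC: "set_integrable lborel (einterval (-\<infinity>) \<infinity>) (\<lambda>t::real. 1 / cosh (pi * t))"
    "(LBINT t=-\<infinity>..\<infinity>. 1 / cosh (pi * t)) = 1 - 0"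
    by (rule interval_integral_FTC_nonneg[where F = ?F];
        use D L U in \<open>auto intro!: continuous_intros simp: ereal_tendsto_simps\<close>)+
  show "integrable lborel (\<lambda>t::real. 1 / cosh (pi * t))"
    using FTC(1) by (simp add: set_integrable_def)
  show "(LINT t|lborel. 1 / cosh (pi * t)) = 1"
    using FTC(2) by (simp add: interval_lebesgue_integral_def set_lebesgue_integral_def)
qed

text \<open>Writing the product with \<open>*\<^sub>R\<close> lets one lemma serve the real cosine
  integrals and the complex function arising from the contour.\<close>

lemma sech_dominated_integrable:
  fixes f :: "real \<Rightarrow> 'a::{banach, second_countable_topology}"
  assumes "f \<in> borel_measurable borel" "\<And>t. norm (f t) \<le> C"
  shows "integrable lborel (\<lambda>t. (1 / cosh (pi * t)) *\<^sub>R f t)"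
proof (rule Bochner_Integration.integrable_bound)
  show "integrable lborel (\<lambda>t. C * (1 / cosh (pi * t)))"
    by (intro integrable_mult_right sech_integrable)
  show "AE t in lborel. norm ((1 / cosh (pi * t)) *\<^sub>R f t) \<le> norm (C * (1 / cosh (pi * t)))"
  proof (intro AE_I2)
    fix t
    have "0 \<le> C" using assms(2)[of 0] norm_ge_zero order_trans by blast
    then show "norm ((1 / cosh (pi * t)) *\<^sub>R f t) \<le> norm (C * (1 / cosh (pi * t)))"
      using assms(2)[of t] by (simp add: divide_right_mono)
  qed
  note assms(1)[measurable]
  show "(\<lambda>t. (1 / cosh (pi * t)) *\<^sub>R f t) \<in> borel_measurable lborel"
    by measurable
qed

section \<open>Cauchy's theorem on the strip of height 1\<close>

text \<open>Reverse triangle inequality for the two exponentials in \<open>cosh z\<close>, whose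
  norms are exp (Re z) and exp (- Re z). It confines the zeros of cosh to the imaginary axis and
  makes the vertical sides of the contour negligible.\<close>

lemma norm_cosh_ge: "norm (cosh z) \<ge> \<bar>sinh (Re z)\<bar>" for z :: complex
proof -
  have "\<bar>norm (exp z) - norm (- exp (- z))\<bar> \<le> norm (exp z - - exp (-z))"
    by (rule norm_triangle_ineq3)
  then show ?thesis
    by (simp add: cosh_field_def sinh_field_def norm_divide)
qed

text \<open>A zero must have real part 0 by \<open>norm_cosh_ge\<close>. On the imaginary axis the
  function is cos (pi * Im z), and cosine is injective on the interval from 0 to pi.\<close>

lemma cosh_pi_eq_0_strip:
  fixes z :: complex
  assumes "cosh (of_real pi * z) = 0" "0 \<le> Im z" "Im z \<le> 1"
  shows "z = \<i> / 2"
proof -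
  have "\<bar>sinh (pi * Re z)\<bar> \<le> 0"
    using norm_cosh_ge[of "of_real pi * z"] assms(1) by simp
  then have re: "Re z = 0" by simp
  then have z: "z = \<i> * of_real (Im z)"
    by (simp add: complex_eq_iff)
  have "cosh (of_real pi * z) = of_real (cos (pi * Im z))"
    by (subst z) (simp add: cosh_conv_cos cos_of_real[symmetric] algebra_simps)
  with assms(1) have "complex_of_real (cos (pi * Im z)) = 0" by simp
  then have "cos (pi * Im z) = cos (pi / 2)"
    by (simp only: of_real_eq_0_iff cos_pi_half)
  then have "pi * Im z = pi / 2"
    using assms(2,3) cos_inj_pi[of "pi * Im z" "pi / 2"] by simp
  then show ?thesis
    using re by (simp add: complex_eq_iff)
qed

text \<open>With a primitive G of E on the strip, the two horizontal integrals are differences of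
  values of G at the four corners. Regrouping these values by vertical side leaves two increments of
  G over segments of length 1, each at most B. The finite set K makes room for a removable
  singularity.\<close>

lemma strip_shift_integral_bound:
  fixes E :: "complex \<Rightarrow> complex" and a b B :: real
  defines "S \<equiv> {z. 0 \<le> Im z \<and> Im z \<le> 1}"
  assumes cont: "continuous_on S E" and "finite K"
    and diff: "\<And>z. z \<in> S - K \<Longrightarrow> E field_differentiable at z"
    and "a \<le> b"
    and side: "\<And>z. z \<in> S \<Longrightarrow> Re z = a \<or> Re z = b \<Longrightarrow> norm (E z) \<le> B"
  shows "norm (integral {a..b} (\<lambda>t. E (of_real t) - E (of_real t + \<i>))) \<le> 2 * B"
proof -
  have "S = {z. 0 \<le> Im z} \<inter> {z. Im z \<le> 1}" by (auto simp: S_def)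
  then have "convex S"
    by (simp add: convex_Int convex_halfspace_Im_ge convex_halfspace_Im_le)
  have fd: "E field_differentiable at z" if "z \<in> interior S - K" for z
    using that interior_subset[of S] by (intro diff) blast
  \<comment> \<open>The primitive is taken within the closed strip, because the two horizontal lines
    of integration lie on its boundary.\<close>
  obtain G where G: "\<And>z. z \<in> S \<Longrightarrow> (G has_field_derivative E z) (at z within S)"
    using holomorphic_convex_primitive[OF \<open>convex S\<close> \<open>finite K\<close> cont fd] by metis
  have line: "((\<lambda>t. E (of_real t + of_real y * \<i>)) has_integral
      (G (of_real b + of_real y * \<i>) - G (of_real a + of_real y * \<i>))) {a..b}"
    if y: "0 \<le> y" "y \<le> 1" for y :: real
  proof (rule fundamental_theorem_of_calculus[OF \<open>a \<le> b\<close>])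
    fix t assume "t \<in> {a..b}"
    let ?p = "\<lambda>t. complex_of_real t + of_real y * \<i>"
    have 1: "(?p has_vector_derivative 1) (at t within {a..b})"
      by (auto intro!: derivative_eq_intros)
    have p: "?p u \<in> S" for u
      using y by (simp add: S_def)
    have "(G has_field_derivative E (?p t)) (at (?p t) within ?p ` {a..b})"
      by (rule DERIV_subset[OF G[OF p]]) (use p in blast)
    from field_vector_diff_chain_within[OF 1 this]
    show "((\<lambda>t. G (?p t)) has_vector_derivative E (?p t)) (at t within {a..b})"
      by (simp add: o_def)
  qed
  have vert: "norm (G (of_real r + \<i>) - G (of_real r)) \<le> B" if r: "r = a \<or> r = b" for r :: real
  proof -
    let ?V = "closed_segment (complex_of_real r) (of_real r + \<i>)"
    have V: "Re z = r \<and> z \<in> S" if "z \<in> ?V" for z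
      using that closed_segment_same_Re[of "of_real r" "of_real r + \<i>"]
      by (simp add: closed_segment_eq_real_ivl S_def)
    have "norm (G (of_real r + \<i>) - G (of_real r)) \<le> B * norm (of_real r + \<i> - of_real r)"
    proof (rule field_differentiable_bound[where S = ?V and f' = E])
      fix z assume z: "z \<in> ?V"
      show "(G has_field_derivative E z) (at z within ?V)"
        by (rule DERIV_subset[OF G]) (use V z in blast)+
      show "norm (E z) \<le> B" using V[OF z] r side by blast
    qed simp_all
    then show ?thesis by simp
  qed
  have "((\<lambda>t. E (of_real t) - E (of_real t + \<i>)) has_integral
      (G (of_real b) - G (of_real a)) - (G (of_real b + \<i>) - G (of_real a + \<i>))) {a..b}"
    using has_integral_diff[OF line[of 0] line[of 1]] by simp
  then have "integral {a..b} (\<lambda>t. E (of_real t) - E (of_real t + \<i>))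
      = (G (of_real a + \<i>) - G (of_real a)) - (G (of_real b + \<i>) - G (of_real b))"
    by (simp add: integral_unique)
  also have "norm \<dots> \<le> B + B"
    by (intro order_trans[OF norm_triangle_ineq4] add_mono vert) auto
  finally show ?thesis by simp
qed

text \<open>Subtracting \<open>exp (- pi * x)\<close> from the Fourier kernel makes the singularity of
  \<open>1 / cosh (pi * z)\<close> at \<open>\<i> / 2\<close> removable, so Cauchy's theorem on the strip
  \<open>0 \<le> Im z \<le> 1\<close> needs no residue: the known integral of \<open>1 / cosh (pi * t)\<close> takes its place.\<close>

lemma sech_fourier: "(LINT t|lborel. cos (2 * pi * x * t) / cosh (pi * t)) = 1 / cosh (pi * x)"
proof -
  \<comment> \<open>The subtracted constant is the value of the kernel at \<i> / 2, so that
    numerator and denominator vanish there together.\<close>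
  define N where "N = (\<lambda>z. exp (2 * pi * \<i> * x * z) - complex_of_real (exp (- pi * x)))"
  define D where "D = (\<lambda>z::complex. cosh (of_real pi * z))"
  \<comment> \<open>The l'Hopital quotient of the derivatives of \<open>N\<close> and
    \<open>D\<close> at \<i> / 2, which is the value that makes \<open>E\<close> continuous there.
    The zero of \<open>D\<close> is simple because its derivative involves a nonzero sinh (fact
    \<open>s_nz\<close>).\<close>
  define c where "c = 2 * pi * \<i> * x * exp (2 * pi * \<i> * x * (\<i> / 2)) / (pi * sinh (of_real pi * (\<i> / 2)))"
  define E where "E = (\<lambda>z. if z = \<i> / 2 then c else N z / D z)"
  define S where "S = {z. 0 \<le> Im z \<and> Im z \<le> 1}"
  have N': "(N has_field_derivative 2 * pi * \<i> * x * exp (2 * pi * \<i> * x * z)) (at z)" for z :: complex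
    unfolding N_def by (auto intro!: derivative_eq_intros)
  have D': "(D has_field_derivative pi * sinh (of_real pi * z)) (at z)" for z :: complex
    unfolding D_def by (auto intro!: derivative_eq_intros)
  have D_nz: "D z \<noteq> 0" if "z \<in> S" "z \<noteq> \<i> / 2" for z
    using cosh_pi_eq_0_strip[of z] that unfolding D_def S_def by auto
  have half_pi: "\<i> * (complex_of_real pi * \<i>) / 2 = - complex_of_real (pi / 2)"
    by (simp add: complex_eq_iff)
  have D_0: "D (\<i> / 2) = 0"
    by (simp add: D_def cosh_conv_cos half_pi cos_of_real sin_of_real del: of_real_divide)
  have s_nz: "sinh (of_real pi * (\<i> / 2)) \<noteq> 0"
    by (simp add: sinh_conv_sin half_pi cos_of_real sin_of_real del: of_real_divide)
  have N_0: "N (\<i> / 2) = 0"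
  proof -
    have "2 * pi * \<i> * x * (\<i> / 2) = complex_of_real (- pi * x)"
      by (simp add: complex_eq_iff)
    then show ?thesis
      by (simp only: N_def exp_of_real) simp
  qed
  have lim: "(E \<longlongrightarrow> E (\<i> / 2)) (at (\<i> / 2))"
  proof -
    have "((\<lambda>w. N w / D w) \<longlongrightarrow> c) (at (\<i> / 2))"
      by (rule lhopital_complex_simple[OF N' D' N_0 D_0]) (use s_nz in \<open>auto simp: c_def\<close>)
    then have "(E \<longlongrightarrow> c) (at (\<i> / 2))"
      by (rule Lim_transform_eventually) (auto simp: E_def eventually_at_filter)
    then show ?thesis by (simp add: E_def)
  qed
  have diff: "E field_differentiable at z" if "z \<in> S" "z \<noteq> \<i> / 2" for z
  proof -
    have nz: "D z \<noteq> 0" using D_nz that by blast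
    obtain e where "((\<lambda>w. N w / D w) has_field_derivative e) (at z)"
      using DERIV_divide[OF N' D' nz] by blast
    then have "(E has_field_derivative e) (at z)"
      by (rule has_field_derivative_transform_within_open[where S = "- {\<i> / 2}"])
        (use that in \<open>auto simp: E_def\<close>)
    then show ?thesis by (auto simp: field_differentiable_def)
  qed
  have cont: "continuous_on S E"
  proof (intro continuous_at_imp_continuous_on ballI)
    fix z assume "z \<in> S"
    show "isCont E z"
    proof (cases "z = \<i> / 2")
      case True
      then show ?thesis using lim unfolding isCont_def by blast
    next
      case False
      then show ?thesis
        using diff[OF \<open>z \<in> S\<close>, THEN field_differentiable_imp_continuous_at] by blast
    qed
  qed
  \<comment> \<open>On the strip the kernel has norm exp (- 2 * pi * x * Im z) with Im z between 0
    and 1, so \<open>B\<close> bounds \<open>N\<close> there whatever the sign of x.\<close>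
  define B where "B = exp (2 * pi * \<bar>x\<bar>) + exp (- pi * x)"
  have side: "norm (E z) \<le> B / sinh (pi * \<bar>Re z\<bar>)" if z: "z \<in> S" "Re z \<noteq> 0" for z
  proof -
    have "norm (exp (2 * pi * \<i> * x * z)) = exp (2 * pi * (- x * Im z))"
      unfolding norm_exp_eq_Re by simp
    also have "\<dots> \<le> exp (2 * pi * \<bar>x\<bar>)"
    proof -
      have "- x * Im z \<le> \<bar>x\<bar> * 1"
        by (rule order_trans[OF abs_ge_self]) (use z in \<open>auto simp: S_def abs_mult intro!: mult_left_le\<close>)
      then have "2 * pi * (- x * Im z) \<le> 2 * pi * \<bar>x\<bar>"
        by (intro mult_left_mono) simp_all
      then show ?thesis by simp
    qed
    finally have "norm (N z) \<le> B"
      unfolding N_def B_def by (intro order_trans[OF norm_triangle_ineq4] add_mono) simp_all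
    moreover have "sinh (pi * \<bar>Re z\<bar>) \<le> norm (D z)"
    proof -
      have "sinh (pi * \<bar>Re z\<bar>) = \<bar>sinh (pi * Re z)\<bar>"
        by (simp add: abs_mult flip: sinh_real_abs)
      then show ?thesis
        using norm_cosh_ge[of "of_real pi * z"] by (simp add: D_def)
    qed
    moreover have "sinh (pi * \<bar>Re z\<bar>) > 0" using z by simp
    moreover have "E z = N z / D z"
    proof -
      have "z \<noteq> \<i> / 2" using z(2) unfolding complex_eq_iff by simp
      then show ?thesis unfolding E_def by (rule if_not_P)
    qed
    moreover have "0 \<le> B" by (simp add: B_def)
    ultimately show ?thesis
      by (simp add: norm_divide frac_le)
  qed

  \<comment> \<open>This is E(t) - E(t + \<i>). Shifting by \<i> changes the sign of cosh (pi * t)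
    and multiplies the kernel by exp (- 2 * pi * x), so the kernel terms add up and the subtracted
    constant doubles.\<close>
  define f where "f = (\<lambda>t::real. (1 / cosh (pi * t)) *\<^sub>R
    ((1 + of_real (exp (- 2 * pi * x))) * cis (2 * pi * x * t) - 2 * complex_of_real (exp (- pi * x))))"
  have f_eq: "f t = E (of_real t) - E (of_real t + \<i>)" for t
  proof -
    have ch: "cosh (complex_of_real pi * of_real t) = complex_of_real (cosh (pi * t))"
      by (simp add: cosh_field_def exp_of_real flip: of_real_mult of_real_minus)
    moreover have "cosh (complex_of_real pi * (of_real t + \<i>)) = - complex_of_real (cosh (pi * t))"
      unfolding ch[symmetric] by (simp add: cosh_field_def distrib_left exp_add exp_diff exp_minus field_simps)
    moreover have "exp (2 * pi * \<i> * x * (of_real t + \<i>)) = of_real (exp (- 2 * pi * x)) * cis (2 * pi * x * t)"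
      by (simp add: cis_conv_exp exp_of_real[symmetric] algebra_simps flip: exp_add)
    moreover have "exp (2 * pi * \<i> * x * of_real t) = cis (2 * pi * x * t)"
      by (simp add: cis_conv_exp algebra_simps)
    moreover have "of_real t \<noteq> \<i> / 2" "of_real t + \<i> \<noteq> \<i> / 2"
      unfolding complex_eq_iff by simp_all
    ultimately show ?thesis
      by (simp add: E_def N_def D_def f_def scaleR_conv_of_real divide_simps distrib_right)
  qed
  have f_int: "integrable lborel f"
    unfolding f_def
  proof (rule sech_dominated_integrable[where C = "(1 + exp (- 2 * pi * x)) + 2 * exp (- pi * x)"])
    fix t
    show "norm ((1 + of_real (exp (- 2 * pi * x))) * cis (2 * pi * x * t) - 2 * complex_of_real (exp (- pi * x)))
       \<le> (1 + exp (- 2 * pi * x)) + 2 * exp (- pi * x)"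
    proof -
      have "norm (1 + complex_of_real (exp (- 2 * pi * x))) = 1 + exp (- 2 * pi * x)"
        by (metis abs_of_pos add_pos_pos exp_gt_zero norm_of_real of_real_1 of_real_add zero_less_one)
      then show ?thesis
        by (intro order_trans[OF norm_triangle_ineq4] add_mono) (simp_all add: norm_mult)
    qed
  qed (unfold cis_conv_exp, measurable)
  have "(\<lambda>n::nat. integral {-real n..real n} f) \<longlonglongrightarrow> 0"
  proof (rule Lim_null_comparison)
    show "\<forall>\<^sub>F n::nat in sequentially. norm (integral {-real n..real n} f) \<le> 2 * (B / sinh (pi * real n))"
      using eventually_gt_at_top[of 0]
    proof eventually_elim
      fix n :: nat assume "n > 0"
      have "norm (integral {-real n..real n} (\<lambda>t. E (of_real t) - E (of_real t + \<i>)))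
          \<le> 2 * (B / sinh (pi * real n))"
      proof (rule strip_shift_integral_bound[where K = "{\<i> / 2}"])
        fix z assume "z \<in> {z. 0 \<le> Im z \<and> Im z \<le> 1}" "Re z = - real n \<or> Re z = real n"
        then have "z \<in> S" "Re z \<noteq> 0" "\<bar>Re z\<bar> = real n"
          using \<open>n > 0\<close> by (auto simp: S_def)
        then show "norm (E z) \<le> B / sinh (pi * real n)"
          using side[of z] by simp
      qed (use cont diff in \<open>simp_all add: S_def\<close>)
      then show "norm (integral {-real n..real n} f) \<le> 2 * (B / sinh (pi * real n))"
        by (simp only: f_eq[abs_def])
    qed
    show "(\<lambda>n::nat. 2 * (B / sinh (pi * real n))) \<longlonglongrightarrow> 0"
      unfolding sinh_field_def by real_asymp
  qed
  then have "(LINT t|lborel. f t) = 0"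
    using integral_symmetric_tendsto[OF f_int] LIMSEQ_unique by blast
  \<comment> \<open>The real part of the vanishing integral is a linear equation for the cosine
    integral, and \<open>sech_integral\<close> evaluates its constant term.\<close>
  then have "0 = (LINT t|lborel. Re (f t))"
    using integral_Re[OF f_int] by simp
  also have "\<dots> = (LINT t|lborel. (1 + exp (- 2 * pi * x)) * (cos (2 * pi * x * t) / cosh (pi * t))
      - 2 * exp (- pi * x) * (1 / cosh (pi * t)))"
    by (intro Bochner_Integration.integral_cong) (auto simp: f_def diff_divide_distrib)
  also have "\<dots> = (1 + exp (- 2 * pi * x)) * (LINT t|lborel. cos (2 * pi * x * t) / cosh (pi * t))
      - 2 * exp (- pi * x) * (LINT t|lborel. 1 / cosh (pi * t))"
  proof -
    have "integrable lborel (\<lambda>t. cos (2 * pi * x * t) / cosh (pi * t))"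
      using sech_dominated_integrable[of "\<lambda>t. cos (2 * pi * x * t)" 1] by simp
    then show ?thesis
      by (subst Bochner_Integration.integral_diff)
        (intro integrable_mult_right sech_integrable | simp only: integral_mult_right_zero)+
  qed
  finally have "(1 + exp (- 2 * pi * x)) * (LINT t|lborel. cos (2 * pi * x * t) / cosh (pi * t)) = 2 * exp (- pi * x)"
    using sech_integral by simp
  moreover have "1 + exp (- 2 * pi * x) = 2 * exp (- pi * x) * cosh (pi * x)"
  proof -
    have "exp (- 2 * pi * x) = exp (- pi * x) * exp (- pi * x)"
      by (simp flip: exp_add)
    moreover have "exp (- pi * x) * exp (pi * x) = 1"
      by (simp flip: exp_add)
    ultimately show ?thesis by (simp add: cosh_field_def distrib_left)
  qed
  ultimately have "2 * exp (- pi * x) * (cosh (pi * x) * (LINT t|lborel. cos (2 * pi * x * t) / cosh (pi * t)))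
      = 2 * exp (- pi * x) * 1"
    by (simp only: mult.assoc mult_1_right)
  then have "cosh (pi * x) * (LINT t|lborel. cos (2 * pi * x * t) / cosh (pi * t)) = 1"
    by (simp only: mult_cancel_left) simp
  then show ?thesis by (simp add: field_simps)
qed

section \<open>Gaussian integrals\<close>

lemma gaussian_integrable:
  assumes "a > 0"
  shows "integrable lborel (\<lambda>x::real. exp (- pi * a * x\<^sup>2))"
proof -
  have "integrable lborel (\<lambda>x. sqrt (2 * pi) * std_normal_density (0 + sqrt (2 * pi * a) * x))"
    using assms by (intro integrable_mult_right lborel_integrable_real_affine) auto
  then show ?thesis
    using assms by (simp add: std_normal_density_def power_mult_distrib real_sqrt_mult mult.assoc)
qed

text \<open>A rescaling of the characteristic function exp (- t^2 / 2) of the standard normal law.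
  Substituting c * x with c = sqrt (2 * pi * a) turns the density's exponent into - pi * a * x^2,
  and t = 2 * pi * u / c makes the frequency t * c equal to 2 * pi * u.\<close>

lemma gaussian_fourier:
  assumes "a > 0"
  shows "(LINT x|lborel. exp (- pi * a * x\<^sup>2) * cos (2 * pi * u * x)) = exp (- pi * u\<^sup>2 / a) / sqrt a"
proof -
  define c where "c = sqrt (2 * pi * a)"
  have c: "c > 0" "c\<^sup>2 = 2 * pi * a" using assms by (auto simp: c_def)
  define t where "t = 2 * pi * u / c"
  have "exp (- (t\<^sup>2) / 2) = Re (char std_normal_distribution t)"
    by (simp add: char_std_normal_distribution)
  also have "\<dots> = (LINT x|std_normal_distribution. Re (iexp (t * x)))"
  proof -
    interpret real_distribution std_normal_distribution
      by (rule real_dist_normal_dist)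
    show ?thesis
      unfolding char_def by (subst integral_Re) (auto intro!: integrable_const_bound[of _ 1])
  qed
  also have "\<dots> = (LINT x|lborel. std_normal_density x * cos (t * x))"
    by (subst integral_density) (auto simp: Re_exp)
  also have "\<dots> = c * (LINT x|lborel. std_normal_density (0 + c * x) * cos (t * (0 + c * x)))"
    using c by (subst lborel_integral_real_affine[of c _ 0]) auto
  also have "\<dots> = c * (LINT x|lborel. 1 / sqrt (2 * pi) * (exp (- pi * a * x\<^sup>2) * cos (2 * pi * u * x)))"
    using c by (simp add: std_normal_density_def power_mult_distrib t_def mult.assoc)
  also have "\<dots> = sqrt a * (LINT x|lborel. exp (- pi * a * x\<^sup>2) * cos (2 * pi * u * x))"
    by (subst integral_mult_right_zero) (simp add: c_def real_sqrt_mult)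
  also have "exp (- (t\<^sup>2) / 2) = exp (- pi * u\<^sup>2 / a)"
  proof -
    have "t\<^sup>2 / 2 = pi * u\<^sup>2 / a"
      using assms c by (simp add: t_def power_divide power_mult_distrib) (simp add: power2_eq_square field_simps)
    then show ?thesis by simp
  qed
  finally show ?thesis using assms by (simp add: field_simps)
qed

lemma gaussian_pair_integrable:
  assumes "\<alpha> > 0" "case_prod g \<in> borel_measurable (lborel \<Otimes>\<^sub>M lborel)" "\<And>t w. \<bar>g t w\<bar> \<le> 1"
  shows "integrable (lborel \<Otimes>\<^sub>M lborel) (\<lambda>(t, w). exp (- pi * \<alpha> * (t\<^sup>2 + w\<^sup>2)) * g t w)"
proof (rule integrable_pair_dominated[OF gaussian_integrable[OF assms(1)] gaussian_integrable[OF assms(1)]])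
  fix t w
  show "\<bar>exp (- pi * \<alpha> * (t\<^sup>2 + w\<^sup>2)) * g t w\<bar> \<le> exp (- pi * \<alpha> * t\<^sup>2) * exp (- pi * \<alpha> * w\<^sup>2)"
    using assms(3)[of t w] by (simp add: abs_mult distrib_left mult_left_le flip: exp_add)
qed (use assms(2) in measurable)

text \<open>The Fourier transform of a product is the convolution of the transforms. Here
  \<open>sech_fourier\<close> expands the secant, Fubini exchanges the integrals, and the
  product-to-sum formula for cosines turns the inner integral into Gaussian transforms at c + t and
  c - t.\<close>

lemma gaussian_sech_fourier:
  assumes "\<alpha> > 0"
  shows "(LINT x|lborel. cos (2 * pi * c * x) * exp (- pi * x\<^sup>2 / (2 * \<alpha>)) / cosh (pi * x)) =
    sqrt (2 * \<alpha>) * (LINT t|lborel. exp (- 2 * pi * \<alpha> * (c + t)\<^sup>2) / cosh (pi * t))"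
proof -
  \<comment> \<open>Chosen so that exp (- pi * a * x^2) is the Gaussian of the statement. The factor
    1 / sqrt a of its transform is then sqrt (2 * \<alpha>).\<close>
  define a where "a = 1 / (2 * \<alpha>)"
  have a: "a > 0" using assms by (simp add: a_def)
  define g where "g = (\<lambda>x::real. exp (- pi * a * x\<^sup>2))"
  have g: "integrable lborel g"
    unfolding g_def by (rule gaussian_integrable[OF a])
  have [measurable]: "g \<in> borel_measurable borel" unfolding g_def by measurable
  define G where "G = (\<lambda>u. exp (- pi * u\<^sup>2 / a) / sqrt a)"
  have G_eq: "G u = sqrt (2 * \<alpha>) * exp (- 2 * pi * \<alpha> * u\<^sup>2)" for u
    using assms by (simp add: G_def a_def real_sqrt_divide mult_ac)
  have g_cos: "integrable lborel (\<lambda>x. g x * cos (2 * pi * u * x))" for u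
    by (rule integrable_mult_bounded[OF g]) auto
  have G_fourier: "G u = (LINT x|lborel. g x * cos (2 * pi * u * x))" for u
    unfolding G_def g_def by (rule gaussian_fourier[OF a, symmetric])
  have shifted: "integrable lborel (\<lambda>t. G (c + s * t) / cosh (pi * t))" for s
  proof -
    have "\<bar>G (c + s * t)\<bar> \<le> 1 / sqrt a" for t
      using a by (simp add: G_def divide_right_mono)
    then have "integrable lborel (\<lambda>t. (1 / cosh (pi * t)) *\<^sub>R G (c + s * t))"
      unfolding G_def by (intro sech_dominated_integrable[where C = "1 / sqrt a"]) auto
    then show ?thesis by simp
  qed
  have "(LINT x|lborel. cos (2 * pi * c * x) * exp (- pi * x\<^sup>2 / (2 * \<alpha>)) / cosh (pi * x))
      = (LINT x|lborel. LINT t|lborel. g x * cos (2 * pi * c * x) * (cos (2 * pi * x * t) / cosh (pi * t)))"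
    by (simp only: integral_mult_right_zero sech_fourier) (simp add: g_def a_def mult.commute)
  also have "\<dots> = (LINT t|lborel. LINT x|lborel. g x * cos (2 * pi * c * x) * (cos (2 * pi * x * t) / cosh (pi * t)))"
  proof (rule lborel_pair.Fubini_integral[symmetric], rule integrable_pair_dominated[OF g sech_integrable])
    fix x t :: real
    have "\<bar>cos (2 * pi * c * x) * cos (2 * pi * x * t)\<bar> \<le> 1 * 1"
      unfolding abs_mult by (intro mult_mono) auto
    then have "g x / cosh (pi * t) * \<bar>cos (2 * pi * c * x) * cos (2 * pi * x * t)\<bar> \<le> g x / cosh (pi * t)"
      by (intro mult_left_le) (auto simp: g_def)
    moreover have "\<bar>g x * cos (2 * pi * c * x) * (cos (2 * pi * x * t) / cosh (pi * t))\<bar>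
        = g x / cosh (pi * t) * \<bar>cos (2 * pi * c * x) * cos (2 * pi * x * t)\<bar>"
      by (simp add: abs_mult g_def)
    ultimately show "\<bar>g x * cos (2 * pi * c * x) * (cos (2 * pi * x * t) / cosh (pi * t))\<bar>
        \<le> g x * (1 / cosh (pi * t))"
      by simp
  qed measurable
  \<comment> \<open>Both shifts are written as c + s * t with s = 1 or s = - 1, so that
    \<open>shifted\<close> covers the two summands at once.\<close>
  also have "\<dots> = (LINT t|lborel. (G (c + 1 * t) / cosh (pi * t) + G (c + (- 1) * t) / cosh (pi * t)) / 2)"
  proof (intro Bochner_Integration.integral_cong refl)
    fix t :: real
    have "(LINT x|lborel. g x * cos (2 * pi * c * x) * (cos (2 * pi * x * t) / cosh (pi * t)))
        = (LINT x|lborel. (g x * cos (2 * pi * (c + t) * x) + g x * cos (2 * pi * (c - t) * x)) * (1 / (2 * cosh (pi * t))))"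
    proof (intro Bochner_Integration.integral_cong refl)
      fix x :: real
      have "cos (2 * pi * (c + t) * x) + cos (2 * pi * (c - t) * x) = 2 * (cos (2 * pi * c * x) * cos (2 * pi * x * t))"
        by (simp add: algebra_simps cos_add cos_diff)
      then have "g x * cos (2 * pi * (c + t) * x) + g x * cos (2 * pi * (c - t) * x)
          = g x * (2 * (cos (2 * pi * c * x) * cos (2 * pi * x * t)))"
        by (metis distrib_left)
      then show "g x * cos (2 * pi * c * x) * (cos (2 * pi * x * t) / cosh (pi * t))
          = (g x * cos (2 * pi * (c + t) * x) + g x * cos (2 * pi * (c - t) * x)) * (1 / (2 * cosh (pi * t)))"
        by simp
    qed
    also have "\<dots> = (G (c + t) + G (c - t)) * (1 / (2 * cosh (pi * t)))"
      unfolding G_fourier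
      by (simp only: integral_mult_left_zero Bochner_Integration.integral_add[OF g_cos g_cos])
    finally show "(LINT x|lborel. g x * cos (2 * pi * c * x) * (cos (2 * pi * x * t) / cosh (pi * t)))
        = (G (c + 1 * t) / cosh (pi * t) + G (c + (- 1) * t) / cosh (pi * t)) / 2"
      by (simp add: add_divide_distrib)
  qed
  also have "\<dots> = ((LINT t|lborel. G (c + 1 * t) / cosh (pi * t)) + (LINT t|lborel. G (c + (- 1) * t) / cosh (pi * t))) / 2"
    by (simp only: integral_divide_zero Bochner_Integration.integral_add[OF shifted shifted])
  \<comment> \<open>The reflection of t preserves cosh (pi * t), so the two shifts contribute
    equally.\<close>
  also have "(LINT t|lborel. G (c + (- 1) * t) / cosh (pi * t)) = (LINT t|lborel. G (c + 1 * t) / cosh (pi * t))"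
    by (subst (2) lborel_integral_real_affine[of "- 1" _ 0]) simp_all
  finally show ?thesis
    by (simp add: G_eq flip: times_divide_eq_right)
qed

section \<open>Mordell integrals\<close>

text \<open>This is phi at the imaginary argument \<i> * s, kept as a real number so that the whole
  computation runs over the reals; \<open>mordell1_imaginary\<close> makes the link to the complex
  definition.\<close>

definition mordell_cosh :: "real \<Rightarrow> real \<Rightarrow> real" where
  "mordell_cosh \<alpha> s = (LINT x:{0..}|lborel. cosh (pi * s * x) / cosh (pi * x) * exp (- pi * \<alpha> * x\<^sup>2))"

lemma mordell1_imaginary: "mordell1 \<alpha> (complex_of_real s * \<i>) = complex_of_real (mordell_cosh \<alpha> s)"
proof -
  have "cos (complex_of_real pi * (complex_of_real s * \<i>) * complex_of_real x) = complex_of_real (cosh (pi * s * x))" for x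
  proof -
    have "complex_of_real pi * (complex_of_real s * \<i>) * complex_of_real x = \<i> * complex_of_real (pi * s * x)"
      by simp
    then show ?thesis
      by (simp only: cosh_conv_cos[symmetric]) (simp add: cosh_field_def exp_of_real flip: of_real_mult of_real_minus)
  qed
  then show ?thesis
    unfolding mordell1_def mordell_cosh_def set_lebesgue_integral_def
    by (simp add: scaleR_conv_of_real flip: integral_complex_of_real of_real_mult of_real_divide)
qed

text \<open>For such s both quotients are bounded by 1 in absolute value, so the Gaussian dominates.
  The sinh version enters through the addition formula in
  \<open>mordell_kernel_integral\<close>.\<close>

lemma mordell_cosh_integrable:
  assumes "\<alpha> > 0" "\<bar>s\<bar> \<le> 1"
  shows "integrable lborel (\<lambda>x. cosh (pi * s * x) / cosh (pi * x) * exp (- pi * \<alpha> * x\<^sup>2))"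
    and "integrable lborel (\<lambda>x. sinh (pi * s * x) / cosh (pi * x) * exp (- pi * \<alpha> * x\<^sup>2))"
proof -
  have c: "cosh (pi * s * x) \<le> cosh (pi * x)" for x
  proof -
    have "\<bar>pi * s * x\<bar> \<le> \<bar>pi * x\<bar>"
      using assms(2) by (simp add: abs_mult mult_left_le_one_le)
    then have "cosh \<bar>pi * s * x\<bar> \<le> cosh \<bar>pi * x\<bar>"
      by (subst cosh_real_nonneg_le_iff) auto
    then show ?thesis by simp
  qed
  have s: "\<bar>sinh u\<bar> \<le> cosh u" for u :: real
    by (simp add: sinh_field_def cosh_field_def abs_le_iff)
  show "integrable lborel (\<lambda>x. cosh (pi * s * x) / cosh (pi * x) * exp (- pi * \<alpha> * x\<^sup>2))"
    using integrable_mult_bounded[OF gaussian_integrable[OF assms(1)], of "\<lambda>x. cosh (pi * s * x) / cosh (pi * x)"] c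
    by (simp add: mult.commute)
  show "integrable lborel (\<lambda>x. sinh (pi * s * x) / cosh (pi * x) * exp (- pi * \<alpha> * x\<^sup>2))"
    using integrable_mult_bounded[OF gaussian_integrable[OF assms(1)], of "\<lambda>x. sinh (pi * s * x) / cosh (pi * x)"]
      order_trans[OF s c]
    by (simp add: mult.commute sinh_field_def)
qed

lemma mordell_cosh_full_line:
  assumes "\<alpha> > 0" "\<bar>s\<bar> \<le> 1"
  shows "(LINT x|lborel. cosh (pi * s * x) / cosh (pi * x) * exp (- pi * \<alpha> * x\<^sup>2)) = 2 * mordell_cosh \<alpha> s"
  unfolding mordell_cosh_def
  using even_integral_half_line[OF mordell_cosh_integrable(1)[OF assms]] by simp

text \<open>The shape of the terms left after symmetrisation. It takes a pair as argument so that it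
  can be integrated directly against the product measure.\<close>

definition mordell_kernel :: "real \<Rightarrow> real \<Rightarrow> real \<Rightarrow> real \<times> real \<Rightarrow> real" where
  "mordell_kernel \<alpha> p q = (\<lambda>(t, w). exp (- pi * \<alpha> * (t\<^sup>2 + w\<^sup>2)) * cosh (pi * (p * t - q * w)) /
     (cosh (pi * t) * cosh (pi * w)))"

text \<open>The addition formula for cosh splits the kernel into a product of even functions minus a
  product of odd ones. The odd product integrates to 0, and each even factor gives twice its
  half-line integral, whence the 4.\<close>

lemma mordell_kernel_integral:
  assumes "\<alpha> > 0" "\<bar>p\<bar> \<le> 1" "\<bar>q\<bar> \<le> 1"
  shows "integrable (lborel \<Otimes>\<^sub>M lborel) (mordell_kernel \<alpha> p q)"
    and "(LINT z|(lborel \<Otimes>\<^sub>M lborel). mordell_kernel \<alpha> p q z) = 4 * mordell_cosh \<alpha> p * mordell_cosh \<alpha> q"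
proof -
  define C where "C = (\<lambda>s x. cosh (pi * s * x) / cosh (pi * x) * exp (- pi * \<alpha> * x\<^sup>2))"
  define S where "S = (\<lambda>s x. sinh (pi * s * x) / cosh (pi * x) * exp (- pi * \<alpha> * x\<^sup>2))"
  have eq: "mordell_kernel \<alpha> p q = (\<lambda>z. (case z of (t, w) \<Rightarrow> C p t * C q w) - (case z of (t, w) \<Rightarrow> S p t * S q w))"
  proof
    fix z :: "real \<times> real"
    obtain t w where z: "z = (t, w)" by (cases z)
    have "exp (- pi * \<alpha> * (t\<^sup>2 + w\<^sup>2)) = exp (- pi * \<alpha> * t\<^sup>2) * exp (- pi * \<alpha> * w\<^sup>2)"
      by (simp add: distrib_left flip: exp_add)
    moreover have "cosh (pi * (p * t - q * w)) = cosh (pi * p * t) * cosh (pi * q * w) - sinh (pi * p * t) * sinh (pi * q * w)"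
      by (simp add: right_diff_distrib cosh_diff mult.assoc)
    ultimately show "mordell_kernel \<alpha> p q z = (case z of (t, w) \<Rightarrow> C p t * C q w) - (case z of (t, w) \<Rightarrow> S p t * S q w)"
      by (simp add: z mordell_kernel_def C_def S_def) (simp add: field_simps)
  qed
  have int: "integrable lborel (C p)" "integrable lborel (C q)" "integrable lborel (S p)" "integrable lborel (S q)"
    using assms mordell_cosh_integrable unfolding C_def S_def by blast+
  have C_int: "(LINT x|lborel. C s x) = 2 * mordell_cosh \<alpha> s" if "\<bar>s\<bar> \<le> 1" for s
    unfolding C_def by (rule mordell_cosh_full_line[OF assms(1) that])
  have "(LINT x|lborel. S p x) = 0"
    by (rule odd_integral_eq_0) (simp add: S_def)
  then show "(LINT z|(lborel \<Otimes>\<^sub>M lborel). mordell_kernel \<alpha> p q z) = 4 * mordell_cosh \<alpha> p * mordell_cosh \<alpha> q"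
    unfolding eq
    by (subst Bochner_Integration.integral_diff) (simp_all add: integrable_tensor int C_int assms)
  show "integrable (lborel \<Otimes>\<^sub>M lborel) (mordell_kernel \<alpha> p q)"
    unfolding eq by (intro Bochner_Integration.integrable_diff integrable_tensor int)
qed

section \<open>From the double Mordell integral to an integral with positive kernel\<close>

lemma mordell2_positive_kernel:
  assumes "\<alpha> > 0" "m > 0"
  shows "mordell2 (1 / \<alpha>) ((2 * m)\<^sup>2 * \<alpha>) (2 * m) = sqrt (2 * \<alpha>) / (8 * m) *
    (LINT t|lborel. LINT w|lborel. exp (- pi * \<alpha> * (t\<^sup>2 + w\<^sup>2)) / (cosh (pi * t) * cosh (pi * (t + w) / (2 * m))))"
proof -
  define K where "K = (\<lambda>c. LINT x|lborel. cos (2 * pi * c * x) * exp (- pi * x\<^sup>2 / (2 * \<alpha>)) / cosh (pi * x))"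
  define h where "h = (\<lambda>y t. exp (- pi * \<alpha> * (t\<^sup>2 + (t + 2 * m * y)\<^sup>2)) / (cosh (pi * t) * cosh (pi * y)))"
  define M where "M = (\<lambda>y. exp (- 2 * pi * m\<^sup>2 * \<alpha> * y\<^sup>2) / cosh (pi * y) * K (m * y))"
  \<comment> \<open>The Gaussian in \<open>h\<close> is merely bounded by 1; the two secants supply
    the integrable majorant.\<close>
  have h_int: "integrable (lborel \<Otimes>\<^sub>M lborel) (case_prod h)"
  proof (rule integrable_pair_dominated[OF sech_integrable sech_integrable])
    fix y t :: real
    have "exp (- pi * \<alpha> * (t\<^sup>2 + (t + 2 * m * y)\<^sup>2)) \<le> 1"
      using assms by simp
    then show "\<bar>h y t\<bar> \<le> 1 / cosh (pi * y) * (1 / cosh (pi * t))"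
      by (simp add: h_def abs_mult divide_right_mono mult.commute)
  qed (unfold h_def, measurable)
  have inner: "(LINT x:{0..}|lborel. cos (pi * (2 * m) * x * y) / (cosh (pi * x) * cosh (pi * y))
         * exp (- pi * (1 / \<alpha> * x\<^sup>2 + (2 * m)\<^sup>2 * \<alpha> * y\<^sup>2) / 2)) = M y / 2" for y
  proof -
    let ?f = "\<lambda>x. cos (2 * pi * (m * y) * x) * exp (- pi * x\<^sup>2 / (2 * \<alpha>)) / cosh (pi * x)"
    have "integrable lborel ?f"
    proof -
      have "\<bar>cos (2 * pi * (m * y) * x) * exp (- pi * x\<^sup>2 / (2 * \<alpha>))\<bar> \<le> 1 * 1" for x
        unfolding abs_mult using assms by (intro mult_mono) auto
      then show ?thesis
        using sech_dominated_integrable[of "\<lambda>x. cos (2 * pi * (m * y) * x) * exp (- pi * x\<^sup>2 / (2 * \<alpha>))" 1] by simp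
    qed
    then have half: "(LINT x:{0..}|lborel. ?f x) = K (m * y) / 2"
      unfolding K_def by (rule even_integral_half_line) simp
    have "(LINT x:{0..}|lborel. cos (pi * (2 * m) * x * y) / (cosh (pi * x) * cosh (pi * y))
         * exp (- pi * (1 / \<alpha> * x\<^sup>2 + (2 * m)\<^sup>2 * \<alpha> * y\<^sup>2) / 2))
        = (LINT x:{0..}|lborel. exp (- 2 * pi * m\<^sup>2 * \<alpha> * y\<^sup>2) / cosh (pi * y) * ?f x)"
    proof (intro set_lebesgue_integral_cong)
      show "\<forall>x. x \<in> {0..} \<longrightarrow> cos (pi * (2 * m) * x * y) / (cosh (pi * x) * cosh (pi * y))
         * exp (- pi * (1 / \<alpha> * x\<^sup>2 + (2 * m)\<^sup>2 * \<alpha> * y\<^sup>2) / 2) = exp (- 2 * pi * m\<^sup>2 * \<alpha> * y\<^sup>2) / cosh (pi * y) * ?f x"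
      proof (intro allI impI)
        fix x
        have "- pi * (1 / \<alpha> * x\<^sup>2 + (2 * m)\<^sup>2 * \<alpha> * y\<^sup>2) / 2 = - 2 * pi * m\<^sup>2 * \<alpha> * y\<^sup>2 + - pi * x\<^sup>2 / (2 * \<alpha>)"
          using assms by (simp add: field_simps power2_eq_square)
        moreover have "pi * (2 * m) * x * y = 2 * pi * (m * y) * x" by simp
        ultimately show "cos (pi * (2 * m) * x * y) / (cosh (pi * x) * cosh (pi * y))
         * exp (- pi * (1 / \<alpha> * x\<^sup>2 + (2 * m)\<^sup>2 * \<alpha> * y\<^sup>2) / 2) = exp (- 2 * pi * m\<^sup>2 * \<alpha> * y\<^sup>2) / cosh (pi * y) * ?f x"
          by (simp only: exp_add) (simp add: mult.commute mult.left_commute)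
      qed
    qed simp
    also have "\<dots> = M y / 2"
      unfolding set_integral_mult_right half M_def by simp
    finally show ?thesis .
  qed
  have M_eq: "M y = sqrt (2 * \<alpha>) * (LINT t|lborel. h y t)" for y
  proof -
    have "M y = sqrt (2 * \<alpha>) * (LINT t|lborel. exp (- 2 * pi * m\<^sup>2 * \<alpha> * y\<^sup>2) / cosh (pi * y)
        * (exp (- 2 * pi * \<alpha> * (m * y + t)\<^sup>2) / cosh (pi * t)))"
      unfolding M_def K_def gaussian_sech_fourier[OF assms(1)]
      by (simp only: integral_mult_right_zero mult.left_commute)
    also have "(LINT t|lborel. exp (- 2 * pi * m\<^sup>2 * \<alpha> * y\<^sup>2) / cosh (pi * y)
        * (exp (- 2 * pi * \<alpha> * (m * y + t)\<^sup>2) / cosh (pi * t))) = (LINT t|lborel. h y t)"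
    proof (intro Bochner_Integration.integral_cong refl)
      fix t :: real
      \<comment> \<open>The parallelogram law for m * y + t and m * y, whose sum is t + 2 * m * y
        and whose difference is t.\<close>
      have "- pi * \<alpha> * (t\<^sup>2 + (t + 2 * m * y)\<^sup>2) = - 2 * pi * m\<^sup>2 * \<alpha> * y\<^sup>2 + - 2 * pi * \<alpha> * (m * y + t)\<^sup>2"
        by (simp add: algebra_simps power2_eq_square)
      then show "exp (- 2 * pi * m\<^sup>2 * \<alpha> * y\<^sup>2) / cosh (pi * y)
        * (exp (- 2 * pi * \<alpha> * (m * y + t)\<^sup>2) / cosh (pi * t)) = h y t"
        by (simp only: h_def exp_add) simp
    qed
    finally show ?thesis .
  qed
  \<comment> \<open>The substitution is w = - (t + 2 * m * y). The minus sign leaves w^2 unchanged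
    but makes t + w equal to - 2 * m * y, so that the remaining secant depends on t + w, which is
    symmetric under the exchange of t and w.\<close>
  have shift: "(LINT y|lborel. h y t) = (LINT w|lborel. exp (- pi * \<alpha> * (t\<^sup>2 + w\<^sup>2)) / (cosh (pi * t) * cosh (pi * (t + w) / (2 * m)))) / (2 * m)" for t
  proof -
    let ?p = "\<lambda>w. exp (- pi * \<alpha> * (t\<^sup>2 + w\<^sup>2)) / (cosh (pi * t) * cosh (pi * (t + w) / (2 * m)))"
    have "?p (- t + (- (2 * m)) * y) = h y t" for y
    proof -
      have "pi * (t + (- t + (- (2 * m)) * y)) / (2 * m) = - (pi * y)"
        using assms by simp
      moreover have "(- t + (- (2 * m)) * y)\<^sup>2 = (t + 2 * m * y)\<^sup>2"
        by (simp add: power2_eq_square algebra_simps)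
      ultimately show ?thesis by (simp only: h_def cosh_minus)
    qed
    then show ?thesis
      using lborel_integral_real_affine[of "- (2 * m)" ?p "- t"] assms by simp
  qed
  have M_int: "integrable lborel M"
    unfolding M_eq[abs_def] using lborel_pair.integrable_fst'[OF h_int] by simp
  have "M (- y) = M y" for y
    by (simp add: M_def K_def)
  with M_int have "(LINT y:{0..}|lborel. M y) = (LINT y|lborel. M y) / 2"
    by (rule even_integral_half_line)
  then have "mordell2 (1 / \<alpha>) ((2 * m)\<^sup>2 * \<alpha>) (2 * m) = (LINT y|lborel. M y) / 4"
    unfolding mordell2_def inner by simp
  also have "(LINT y|lborel. M y) = sqrt (2 * \<alpha>) * (LINT t|lborel. LINT y|lborel. h y t)"
    unfolding M_eq[abs_def] using lborel_pair.Fubini_integral[OF h_int] by simp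
  \<comment> \<open>The constant collects 1 / 4 from the two half-lines, sqrt (2 * \<alpha>) from
    \<open>gaussian_sech_fourier\<close>, and 1 / (2 * m) from the change of variable.\<close>
  finally show ?thesis unfolding shift by simp
qed

section \<open>Symmetrisation and evaluation of the positive kernel\<close>

text \<open>Hyperbolic analogue of a Dirichlet kernel with alternating signs; the induction uses the
  sum-to-product formula for two consecutive odd multiples. Pulling out (-1) ^ n leaves signs
  depending on k alone, and this is the source of the overall sign in the theorem.\<close>

lemma cosh_odd_multiple:
  fixes x :: real
  shows "cosh (real (2 * n + 1) * x) =
    (-1) ^ n * (1 + 2 * (\<Sum>k = 1..n. (-1) ^ k * cosh (2 * real k * x))) * cosh x"
proof (induction n)
  case (Suc n)
  have "cosh (real (2 * Suc n + 1) * x) + cosh (real (2 * n + 1) * x) = 2 * cosh (2 * real (Suc n) * x) * cosh x"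
  proof -
    have "real (2 * Suc n + 1) * x = 2 * real (Suc n) * x + x"
      "real (2 * n + 1) * x = 2 * real (Suc n) * x - x"
      by (simp_all add: algebra_simps)
    then show ?thesis by (simp only: cosh_add cosh_diff)
  qed
  then show ?case
    unfolding Suc by (simp add: algebra_simps flip: power_add)
qed simp

lemma symmetrised_kernel:
  fixes n :: nat and t w :: real
  defines "p \<equiv> \<lambda>k. (2 * real n + 2 * real k + 1) / (4 * real n + 2)"
    and "q \<equiv> \<lambda>k. (2 * real n - 2 * real k + 1) / (4 * real n + 2)"
    and "A \<equiv> pi * (t + w) / (2 * real (2 * n + 1))"
  shows "exp (- pi * \<alpha> * (t\<^sup>2 + w\<^sup>2)) / (cosh (pi * t) * cosh A) + exp (- pi * \<alpha> * (t\<^sup>2 + w\<^sup>2)) / (cosh (pi * w) * cosh A) =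
    (-1) ^ n * (2 * mordell_kernel \<alpha> (1 / 2) (1 / 2) (t, w) +
      2 * (\<Sum>k = 1..n. (-1) ^ k * (mordell_kernel \<alpha> (p k) (q k) (t, w) + mordell_kernel \<alpha> (q k) (p k) (t, w))))"
proof -
  define D where "D = pi * (t - w) / 2"
  define E where "E = exp (- pi * \<alpha> * (t\<^sup>2 + w\<^sup>2)) / (cosh (pi * t) * cosh (pi * w))"
  have mA: "real (2 * n + 1) * A = pi * (t + w) / 2"
    by (simp add: A_def divide_simps del: of_nat_Suc of_nat_add)
  \<comment> \<open>(2 * n + 1) * A and D are half the sum and half the difference of pi * t and pi
    * w.\<close>
  have "cosh (pi * t) + cosh (pi * w) = 2 * cosh (real (2 * n + 1) * A) * cosh D"
  proof -
    have "pi * t = real (2 * n + 1) * A + D" "pi * w = real (2 * n + 1) * A - D"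
      unfolding mA D_def by (simp_all add: field_simps)
    then show ?thesis by (simp only: cosh_add cosh_diff)
  qed
  also have "\<dots> = (-1) ^ n * (2 * cosh D + 2 * (\<Sum>k = 1..n. (-1) ^ k * (2 * cosh (2 * real k * A) * cosh D))) * cosh A"
    unfolding cosh_odd_multiple by (simp add: algebra_simps sum_distrib_left)
  finally have sum: "cosh (pi * t) + cosh (pi * w) = \<dots>" .
  have kernel: "mordell_kernel \<alpha> r s (t, w) = E * cosh (pi * (r * t - s * w))" for r s
    by (simp add: mordell_kernel_def E_def)
  have pq: "E * (2 * cosh (2 * real k * A) * cosh D) =
      mordell_kernel \<alpha> (p k) (q k) (t, w) + mordell_kernel \<alpha> (q k) (p k) (t, w)" for k
  proof -
    define m where "m = real (2 * n + 1)"
    have "m > 0" by (simp add: m_def)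
    \<comment> \<open>With p and q equal to 1 / 2 plus and minus k / m, the numbers D + 2 * k * A
      and D - 2 * k * A become pi * (p * t - q * w) and pi * (q * t - p * w). This is where the
      parameters of the Mordell integrals come from.\<close>
    then have pk: "p k = 1 / 2 + real k / m" "q k = 1 / 2 - real k / m"
      unfolding p_def q_def by (simp_all add: m_def field_simps)
    from \<open>m > 0\<close> have eqs: "pi * (p k * t - q k * w) = D + 2 * real k * A"
      "pi * (q k * t - p k * w) = D - 2 * real k * A"
      unfolding pk D_def A_def m_def[symmetric] by (simp_all add: field_simps)
    then show ?thesis
      unfolding kernel eqs cosh_add cosh_diff by (simp add: algebra_simps)
  qed
  have half: "E * cosh D = mordell_kernel \<alpha> (1 / 2) (1 / 2) (t, w)"
    unfolding kernel D_def by (simp add: field_simps)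
  have "exp (- pi * \<alpha> * (t\<^sup>2 + w\<^sup>2)) / (cosh (pi * t) * cosh A) + exp (- pi * \<alpha> * (t\<^sup>2 + w\<^sup>2)) / (cosh (pi * w) * cosh A)
      = E * (cosh (pi * t) + cosh (pi * w)) / cosh A"
    unfolding E_def by (simp add: field_simps)
  also have "\<dots> = E * ((-1) ^ n * (2 * cosh D + 2 * (\<Sum>k = 1..n. (-1) ^ k * (2 * cosh (2 * real k * A) * cosh D))))"
    unfolding sum by simp
  also have "\<dots> = (-1) ^ n * (2 * (E * cosh D) + 2 * (\<Sum>k = 1..n. (-1) ^ k * (E * (2 * cosh (2 * real k * A) * cosh D))))"
    by (simp add: algebra_simps sum_distrib_left)
  finally show ?thesis unfolding half pq .
qed

text \<open>\<open>h\<close> and \<open>h'\<close> differ by the exchange of t and w, so each has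
  the required value as its plane integral. Twice that value is therefore the integral of the
  symmetrised kernel, which can be evaluated term by term.\<close>

lemma positive_kernel_integral:
  fixes n :: nat
  assumes "\<alpha> > 0"
  shows "(LINT t|lborel. LINT w|lborel. exp (- pi * \<alpha> * (t\<^sup>2 + w\<^sup>2)) / (cosh (pi * t) * cosh (pi * (t + w) / (2 * real (2 * n + 1))))) =
    (-1) ^ n * 4 * ((mordell_cosh \<alpha> (1 / 2))\<^sup>2 + 2 * (\<Sum>k = 1..n. (-1) ^ k *
      mordell_cosh \<alpha> ((2 * real n + 2 * real k + 1) / (4 * real n + 2)) *
      mordell_cosh \<alpha> ((2 * real n - 2 * real k + 1) / (4 * real n + 2))))"
    (is "?P = (-1) ^ n * 4 * (_ + 2 * (\<Sum>k = 1..n. (-1) ^ k * mordell_cosh \<alpha> (?p k) * mordell_cosh \<alpha> (?q k)))")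
proof -
  define h where "h = (\<lambda>t w. exp (- pi * \<alpha> * (t\<^sup>2 + w\<^sup>2)) / (cosh (pi * t) * cosh (pi * (t + w) / (2 * real (2 * n + 1)))))"
  define h' where "h' = (\<lambda>t w. exp (- pi * \<alpha> * (t\<^sup>2 + w\<^sup>2)) / (cosh (pi * w) * cosh (pi * (t + w) / (2 * real (2 * n + 1)))))"
  have bound: "\<bar>1 / (cosh a * cosh b)\<bar> \<le> 1" for a b :: real
    using mult_mono[OF cosh_real_ge_1[of a] cosh_real_ge_1[of b]] by (simp add: abs_mult)
  have h_int: "integrable (lborel \<Otimes>\<^sub>M lborel) (case_prod h)"
    using gaussian_pair_integrable[OF assms, of "\<lambda>t w. 1 / (cosh (pi * t) * cosh (pi * (t + w) / (2 * real (2 * n + 1))))"] bound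
    unfolding h_def by simp
  have h'_int: "integrable (lborel \<Otimes>\<^sub>M lborel) (case_prod h')"
    using gaussian_pair_integrable[OF assms, of "\<lambda>t w. 1 / (cosh (pi * w) * cosh (pi * (t + w) / (2 * real (2 * n + 1))))"] bound
    unfolding h'_def by simp
  have "?P = (LINT z|(lborel \<Otimes>\<^sub>M lborel). case_prod h z)"
    using lborel_pair.integral_fst[OF h_int] by (simp add: h_def)
  \<comment> \<open>Integrating \<open>h'\<close> in the opposite order amounts to renaming the
    variables in \<open>h\<close>.\<close>
  moreover have "?P = (LINT z|(lborel \<Otimes>\<^sub>M lborel). case_prod h' z)"
    using lborel_pair.integral_snd[OF h'_int] by (simp add: h'_def add.commute)
  ultimately have "2 * ?P = (LINT z|(lborel \<Otimes>\<^sub>M lborel). case_prod h z) + (LINT z|(lborel \<Otimes>\<^sub>M lborel). case_prod h' z)"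
    by linarith
  also have "\<dots> = (LINT z|(lborel \<Otimes>\<^sub>M lborel). case_prod h z + case_prod h' z)"
    by (rule Bochner_Integration.integral_add[OF h_int h'_int, symmetric])
  also have "\<dots> = (LINT z|(lborel \<Otimes>\<^sub>M lborel). (-1) ^ n * (2 * mordell_kernel \<alpha> (1 / 2) (1 / 2) z +
      2 * (\<Sum>k = 1..n. (-1) ^ k * (mordell_kernel \<alpha> (?p k) (?q k) z + mordell_kernel \<alpha> (?q k) (?p k) z))))"
  proof (intro Bochner_Integration.integral_cong refl)
    fix z :: "real \<times> real"
    show "case_prod h z + case_prod h' z = (-1) ^ n * (2 * mordell_kernel \<alpha> (1 / 2) (1 / 2) z +
      2 * (\<Sum>k = 1..n. (-1) ^ k * (mordell_kernel \<alpha> (?p k) (?q k) z + mordell_kernel \<alpha> (?q k) (?p k) z)))"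
      unfolding h_def h'_def using symmetrised_kernel[of \<alpha> "fst z" "snd z" n]
      by (simp only: case_prod_unfold prod.collapse)
  qed
  also have "\<dots> = (-1) ^ n * (2 * (4 * mordell_cosh \<alpha> (1 / 2) * mordell_cosh \<alpha> (1 / 2)) +
      2 * (\<Sum>k = 1..n. (-1) ^ k * (4 * mordell_cosh \<alpha> (?p k) * mordell_cosh \<alpha> (?q k) + 4 * mordell_cosh \<alpha> (?q k) * mordell_cosh \<alpha> (?p k))))"
  proof -
    \<comment> \<open>Since k is at most n, the numerators lie between 1 and 4 * n + 1, which keeps
      both parameters in the range required by \<open>mordell_kernel_integral\<close>.\<close>
    have pq: "\<bar>?p k\<bar> \<le> 1" "\<bar>?q k\<bar> \<le> 1" if "k \<in> {1..n}" for k
      using that by (auto simp: abs_le_iff divide_simps)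
    have int: "integrable (lborel \<Otimes>\<^sub>M lborel) (mordell_kernel \<alpha> (1 / 2) (1 / 2))"
      "\<And>k. k \<in> {1..n} \<Longrightarrow> integrable (lborel \<Otimes>\<^sub>M lborel) (mordell_kernel \<alpha> (?p k) (?q k))"
      "\<And>k. k \<in> {1..n} \<Longrightarrow> integrable (lborel \<Otimes>\<^sub>M lborel) (mordell_kernel \<alpha> (?q k) (?p k))"
      using mordell_kernel_integral(1)[OF assms] pq by auto
    have val: "(LINT z|(lborel \<Otimes>\<^sub>M lborel). mordell_kernel \<alpha> (1 / 2) (1 / 2) z) = 4 * mordell_cosh \<alpha> (1 / 2) * mordell_cosh \<alpha> (1 / 2)"
      "\<And>k. k \<in> {1..n} \<Longrightarrow> (LINT z|(lborel \<Otimes>\<^sub>M lborel). mordell_kernel \<alpha> (?p k) (?q k) z) = 4 * mordell_cosh \<alpha> (?p k) * mordell_cosh \<alpha> (?q k)"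
      "\<And>k. k \<in> {1..n} \<Longrightarrow> (LINT z|(lborel \<Otimes>\<^sub>M lborel). mordell_kernel \<alpha> (?q k) (?p k) z) = 4 * mordell_cosh \<alpha> (?q k) * mordell_cosh \<alpha> (?p k)"
      using mordell_kernel_integral(2)[OF assms] pq by auto
    show ?thesis
      by (subst integral_mult_right_zero, subst Bochner_Integration.integral_add)
        (auto simp: int val Bochner_Integration.integral_sum
          intro!: Bochner_Integration.integrable_sum integrable_mult_right Bochner_Integration.integrable_add)
  qed
  \<comment> \<open>The kernels with p and q exchanged have equal integrals, so each pair merges
    into a single product of Mordell integrals.\<close>
  also have "\<dots> = 2 * ((-1) ^ n * 4 * ((mordell_cosh \<alpha> (1 / 2))\<^sup>2 +
      2 * (\<Sum>k = 1..n. (-1) ^ k * mordell_cosh \<alpha> (?p k) * mordell_cosh \<alpha> (?q k))))"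
    by (simp add: power2_eq_square algebra_simps sum_distrib_left)
  finally show ?thesis
    by (simp only: mult_cancel_left) simp
qed

theorem mainTheorem1:
  fixes n :: nat and \<alpha> :: real
  assumes "\<alpha> > 0"
  shows "complex_of_real (mordell2 (1 / \<alpha>) ((4 * real n + 2)\<^sup>2 * \<alpha>) (4 * real n + 2)) =
    (-1) ^ n * (1 / complex_of_real (2 * real n + 1)) * complex_of_real (sqrt (\<alpha> / 2)) *
    ((mordell1 \<alpha> (\<i> / 2))\<^sup>2 +
      2 * (\<Sum>k = 1..n. (-1) ^ k *
        mordell1 \<alpha> (complex_of_real ((2 * real n + 2 * real k + 1) / (4 * real n + 2)) * \<i>) *
        mordell1 \<alpha> (complex_of_real ((2 * real n - 2 * real k + 1) / (4 * real n + 2)) * \<i>)))"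
proof -
  define m where "m = real (2 * n + 1)"
  have m: "m > 0" "4 * real n + 2 = 2 * m" "2 * real n + 1 = m" by (simp_all add: m_def)
  have half: "mordell1 \<alpha> (\<i> / 2) = complex_of_real (mordell_cosh \<alpha> (1 / 2))"
    using mordell1_imaginary[of \<alpha> "1 / 2"] by simp
  define R where "R = (mordell_cosh \<alpha> (1 / 2))\<^sup>2 + 2 * (\<Sum>k = 1..n. (-1) ^ k *
      mordell_cosh \<alpha> ((2 * real n + 2 * real k + 1) / (4 * real n + 2)) *
      mordell_cosh \<alpha> ((2 * real n - 2 * real k + 1) / (4 * real n + 2)))"
  have "mordell2 (1 / \<alpha>) ((4 * real n + 2)\<^sup>2 * \<alpha>) (4 * real n + 2) =
      sqrt (2 * \<alpha>) / (8 * m) * ((-1) ^ n * 4 * R)"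
    unfolding m(2) mordell2_positive_kernel[OF assms m(1)]
    using positive_kernel_integral[OF assms, of n] by (simp only: m_def R_def)
  \<comment> \<open>This 2 and the 4 from \<open>positive_kernel_integral\<close> cancel the 8 in
    the denominator, leaving 1 / m.\<close>
  also have "sqrt (2 * \<alpha>) = 2 * sqrt (\<alpha> / 2)"
    using assms by (intro real_sqrt_unique) (auto simp: power_mult_distrib)
  finally have "mordell2 (1 / \<alpha>) ((4 * real n + 2)\<^sup>2 * \<alpha>) (4 * real n + 2) =
      (-1) ^ n * (1 / (2 * real n + 1)) * sqrt (\<alpha> / 2) * R"
    unfolding m(3) by simp
  then show ?thesis
    unfolding half mordell1_imaginary R_def by simp
qed

end
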